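(* Let $\Lambda$ be a finite or countably infinite set with at least two elements and let $A=(A_{x,y})_{x,y\in\Lambda}$ be the conservative generator of a continuous-time Markov chain $(X_t)_{t\in[0,\infty)}$ on $\Lambda$. Assume that $A$ is symmetric. Fix a finite subset $S$ of $\Lambda$. Then, for any $T\ge 1$ and any $a\in S$, the following bounds hold. (i) For every measurable $\Gamma\subseteq\mathcal{M}_1(S)$, $$\log\mathbb{P}_a\big(\tfrac1T\ell_T\in\Gamma,\ R_T\subseteq S\big)\le -T\inf_{\mu\in\Gamma}\big\|(-A)^{1/2}\sqrt\mu\big\|_2^2+|S|\log\big(\eta_S\sqrt{8\mathrm{e}}\,T\big)+\log|S|+\frac{|S|}{4T}.$$ (ii) For every measurable functional $F\colon\mathcal{M}_1(S)\to\mathbb{R}$, $$\log\mathbb{E}_a\big[\mathrm{e}^{TF(\frac1T\ell_T)}\mathbf{1}_{\{R_T\subseteq S\}}\big]\le T\sup_{\mu\in\mathcal{M}_1(S)}\Big[F(\mu)-\big\|(-A)^{1/2}\sqrt\mu\big\|_2^2\Big]+|S|\log\big(\eta_S\sqrt{8\mathrm{e}}\,T\big)+\log|S|+\frac{|S|}{4T}.$$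
   Context: Conservative generator ($Q$-matrix): $A_{x,y}\ge 0$ for $x\ne y$ and $\sum_{y\in\Lambda}A_{x,y}=0$ for every $x$. Under $\mathbb{P}_a$, with expectation $\mathbb{E}_a$, the chain (with right-continuous paths) starts at $X_0=a$. Local times: $\ell_T(x)=\int_0^T\mathbf{1}_{\{X_s=x\}}\,\mathrm{d}s$. Range: $R_T=\operatorname{supp}(\ell_T)=\{X_s\colon s\in[0,T]\}$. $\mathcal{M}_1(S)$ is the set of probability measures on the finite set $S$ (a subset of $\mathbb{R}^S$ with its Borel $\sigma$-algebra); its elements are extended by $0$ to $\Lambda$. On $\{R_T\subseteq S\}$, $\frac1T\ell_T$ is regarded as an element of $\mathcal{M}_1(S)$. For $\mu\in\mathcal{M}_1(S)$, $\sqrt\mu=(\sqrt{\mu(x)})_{x\in\Lambda}$ and $\|(-A)^{1/2}\sqrt\mu\|_2^2$ is the Dirichlet form of $A$ at $\sqrt\mu$, i.e. $-\sum_{x,y\in S}A_{x,y}\sqrt{\mu(x)}\sqrt{\mu(y)}$. With $B=((1-\delta_{x,y})A_{x,y})_{x,y\in\Lambda}$ the off-diagonal part of $A$, $$\eta_S=\max\Big\{\max_{x\in S}\sum_{y\in S\setminus\{x\}}|B_{x,y}|,\ \max_{y\in S}\sum_{x\in S\setminus\{y\}}|B_{x,y}|,\ 1\Big\}.$$ Conventions: $\log 0=-\infty$, $\inf\emptyset=+\infty$; suprema may be $+\infty$. *)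

theory Defs
  imports "HOL-Probability.Probability"
begin

text \<open>
  The state space \<open>\<Lambda>\<close> is the whole type \<open>'a::countable\<close>, with the discrete topology and
  the discrete sigma-algebra.
\<close>

definition conservative_generator :: "('a \<Rightarrow> 'a \<Rightarrow> real) \<Rightarrow> bool" where
  "conservative_generator A \<longleftrightarrow>
     (\<forall>x y. x \<noteq> y \<longrightarrow> 0 \<le> A x y) \<and> (\<forall>x. (A x has_sum 0) UNIV)"

text \<open>
  A time-homogeneous Markov chain on one measurable space \<open>\<Omega>\<close>, with a family of laws indexed by
  the starting point.  Its transition function is \<open>p\<^sub>t(x, y) = P\<^sub>x(X\<^sub>t = y)\<close>, and \<open>A\<close> is its
  generator in the sense that \<open>A\<close> is the entrywise right derivative of \<open>p\<^sub>t\<close> at \<open>t = 0\<close>.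
  Only times \<open>t \<ge> 0\<close> matter.  Because the topology on the state space is discrete, a path is
  right-continuous at \<open>t\<close> iff it is constant on some \<open>[t, t + \<epsilon>)\<close>.
\<close>

locale continuous_time_markov_chain =
  fixes \<Omega> :: "'w measure"
    and P :: "'a::countable \<Rightarrow> 'w measure"
    and X :: "real \<Rightarrow> 'w \<Rightarrow> 'a"
    and A :: "'a \<Rightarrow> 'a \<Rightarrow> real"
  assumes prob_space_P: "\<And>a. prob_space (P a)"
    and sets_P: "\<And>a. sets (P a) = sets \<Omega>"
    and measurable_X: "\<And>t. 0 \<le> t \<Longrightarrow> X t \<in> measurable \<Omega> (count_space UNIV)"
    and right_continuous:
      "\<And>\<omega> t. \<omega> \<in> space \<Omega> \<Longrightarrow> 0 \<le> t \<Longrightarrow> eventually (\<lambda>s. X s \<omega> = X t \<omega>) (at_right t)"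
    and start: "\<And>a. AE \<omega> in P a. X 0 \<omega> = a"
    and markov_property:
      "\<And>a n (t :: nat \<Rightarrow> real) x s y. 0 \<le> t 0 \<Longrightarrow> mono_on {..n} t \<Longrightarrow> 0 \<le> s \<Longrightarrow>
         measure (P a) {\<omega> \<in> space \<Omega>. (\<forall>i\<le>n. X (t i) \<omega> = x i) \<and> X (t n + s) \<omega> = y} =
         measure (P a) {\<omega> \<in> space \<Omega>. \<forall>i\<le>n. X (t i) \<omega> = x i} *
         measure (P (x n)) {\<omega> \<in> space \<Omega>. X s \<omega> = y}"
    and generator:
      "\<And>x y. ((\<lambda>h. (measure (P x) {\<omega> \<in> space \<Omega>. X h \<omega> = y} - (if x = y then 1 else 0)) / h)
         \<longlongrightarrow> A x y) (at_right 0)"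
    and conservative: "conservative_generator A"

definition local_time :: "(real \<Rightarrow> 'w \<Rightarrow> 'a) \<Rightarrow> real \<Rightarrow> 'w \<Rightarrow> 'a \<Rightarrow> real" where
  "local_time X T \<omega> x = (LINT s:{0..T}|lborel. indicator {x} (X s \<omega>))"

text \<open>
  The visited set.  For right-continuous paths it agrees with the support of the local times,
  except possibly for the state occupied at the final time \<open>T\<close> if a jump occurs exactly at \<open>T\<close>
  (an event of probability 0).
\<close>

definition chain_range :: "(real \<Rightarrow> 'w \<Rightarrow> 'a) \<Rightarrow> real \<Rightarrow> 'w \<Rightarrow> 'a set" where
  "chain_range X T \<omega> = (\<lambda>s. X s \<omega>) ` {0..T}"

text \<open>
  Probability measures on the finite set \<open>S\<close> as mass functions extended by \<open>0\<close>.  Functions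
  vanishing outside \<open>S\<close> form a copy of \<open>\<real>\<^sup>S\<close> inside the product space \<open>'a \<Rightarrow> real\<close>, so the trace
  of the Borel sigma-algebra of the product topology is the Borel sigma-algebra inherited from
  \<open>\<real>\<^sup>S\<close>.
\<close>

definition prob_measures_on :: "'a set \<Rightarrow> ('a \<Rightarrow> real) set" where
  "prob_measures_on S =
     {\<mu>. (\<forall>x. 0 \<le> \<mu> x) \<and> (\<forall>x. x \<notin> S \<longrightarrow> \<mu> x = 0) \<and> (\<Sum>x\<in>S. \<mu> x) = 1}"

definition prob_measures_borel :: "'a set \<Rightarrow> ('a \<Rightarrow> real) measure" where
  "prob_measures_borel S = restrict_space borel (prob_measures_on S)"

text \<open>
  The Dirichlet form \<open>\<parallel>(-A)\<^sup>1\<^sup>/\<^sup>2 g\<parallel>\<^sup>2 = \<langle>g, -A g\<rangle>\<close> for \<open>g\<close> supported in the finite set \<open>S\<close>.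
\<close>

definition dirichlet_form :: "('a \<Rightarrow> 'a \<Rightarrow> real) \<Rightarrow> 'a set \<Rightarrow> ('a \<Rightarrow> real) \<Rightarrow> real" where
  "dirichlet_form A S g = - (\<Sum>x\<in>S. \<Sum>y\<in>S. A x y * g x * g y)"

definition off_diagonal :: "('a \<Rightarrow> 'a \<Rightarrow> real) \<Rightarrow> 'a \<Rightarrow> 'a \<Rightarrow> real" where
  "off_diagonal A x y = (if x = y then 0 else A x y)"

definition eta :: "('a \<Rightarrow> 'a \<Rightarrow> real) \<Rightarrow> 'a set \<Rightarrow> real" where
  "eta A S =
     Max {Max ((\<lambda>x. \<Sum>y\<in>S - {x}. \<bar>off_diagonal A x y\<bar>) ` S),
          Max ((\<lambda>y. \<Sum>x\<in>S - {y}. \<bar>off_diagonal A x y\<bar>) ` S),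
          1}"

definition log_ennreal :: "ennreal \<Rightarrow> ereal" where
  "log_ennreal p =
     (if p = 0 then - \<infinity> else if p = \<infinity> then \<infinity> else ereal (ln (enn2real p)))"

definition error_term :: "('a \<Rightarrow> 'a \<Rightarrow> real) \<Rightarrow> 'a set \<Rightarrow> real \<Rightarrow> real" where
  "error_term A S T =
     real (card S) * ln (eta A S * sqrt (8 * exp 1) * T) + ln (real (card S))
       + real (card S) / (4 * T)"

end

theory Submission
  imports Defs
begin

text \<open>
  The proof is a change of measure, made uniform in the occupation measure by a finite net of
  potentials.

  Let \<open>u > 0\<close> on \<open>S\<close> and \<open>V = - (A\<^sub>S u) / u\<close>, where \<open>A\<^sub>S\<close> is the restriction of \<open>A\<close> to \<open>S \<times> S\<close>.
  Then \<open>(A\<^sub>S + V) u = 0\<close>, and since \<open>A\<close> is symmetric with nonnegative off-diagonal entries, the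
  quadratic form of \<open>A\<^sub>S + V\<close> is minus a sum of squares (\<open>ground_state_form_nonpos\<close>).  So
  \<open>exp (t (A\<^sub>S + V))\<close> is a contraction of \<open>\<ell>\<^sup>2(S)\<close>, and the Feynman-Kac formula bounds the
  expectation of \<open>exp (\<Sum>\<^sub>x V(x) \<ell>\<^sub>T(x))\<close> on the event that the range stays in \<open>S\<close> by the
  \<open>\<ell>\<^sup>2\<close>-norm of the constant function \<open>1\<close>, which is \<open>sqrt |S|\<close> (\<open>feynman_kac_bound\<close>).

  If \<open>u\<close> is proportional to \<open>sqrt \<ell>\<^sub>T\<close>, then \<open>\<Sum>\<^sub>x V(x) \<ell>\<^sub>T(x)\<close> is exactly \<open>T\<close> times the Dirichlet form
  at \<open>sqrt (\<ell>\<^sub>T / T)\<close>.  As \<open>\<ell>\<^sub>T\<close> is random, \<open>u\<close> has to be chosen from a fixed finite set: rounding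
  \<open>sqrt \<ell>\<^sub>T\<close> up to positive multiples of \<open>\<delta> = 1 / (\<eta>\<^sub>S sqrt T)\<close> loses at most \<open>sqrt |S|\<close> in the exponent
  (\<open>dirichlet_form_rounding\<close>), and only \<open>\<lceil>\<eta>\<^sub>S T\<rceil>\<close> multiples per state are needed, because
  \<open>sqrt \<ell>\<^sub>T(x) \<le> sqrt T = \<eta>\<^sub>S T \<delta>\<close>.  Bounding the best net point by the sum over the net gives the
  key estimate (\<open>dirichlet_exponential_moment\<close>): with \<open>I(\<mu>)\<close> the Dirichlet form at \<open>sqrt \<mu>\<close>, the
  expectation of \<open>exp (T I(\<ell>\<^sub>T / T))\<close> on the event that the range stays in \<open>S\<close> is at most
  \<open>exp (sqrt |S|) (2 \<eta>\<^sub>S T) ^ |S| sqrt |S|\<close>, which the stated error term dominates when \<open>|S| \<ge> 2\<close>; for a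
  single state there is no rounding loss.

  Both bounds follow pointwise: on the event in (i), the factor \<open>exp (T I)\<close> is at least \<open>exp (T inf I)\<close>;
  in (ii), \<open>exp (T F)\<close> is at most \<open>exp (T sup (F - I))\<close> times \<open>exp (T I)\<close>.

  The Feynman-Kac bound itself is obtained from the defining properties of the chain by
  discretizing time.  On a grid of mesh \<open>h\<close> the Markov property turns the expectation into an entry of
  \<open>K\<^sub>h ^ N 1\<close>, where \<open>K\<^sub>h(x, y) = p\<^sub>h(x, y) exp (h V(y))\<close> on \<open>S \<times> S\<close>.  The generator is the entrywise
  derivative of \<open>p\<^sub>h\<close>, so \<open>K\<^sub>h = 1 + h (A\<^sub>S + V) + o(h)\<close> multiplies squared norms by at most \<open>1 + o(h)\<close>,
  and \<open>N = T / h\<close> steps cost nothing in the limit.  Right-continuity of the paths makes the Riemann sums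
  converge to the local times, and Fatou's lemma passes to the limit.
\<close>

section \<open>Riemann sums of right-continuous functions\<close>

text \<open>
  Right endpoints are what right-continuity calls for: the grid point following \<open>s\<close> tends to \<open>s\<close> from
  the right, so the step functions \<open>\<psi> N\<close> below converge pointwise to \<open>\<phi>\<close> on \<open>[0, T]\<close>, which also gives
  the measurability of \<open>\<phi>\<close> there, and dominated convergence applies.
\<close>

lemma right_endpoint_sums_tendsto_integral:
  fixes \<phi> :: "real \<Rightarrow> real"
  assumes T: "0 < T"
    and right_cont: "\<And>t. 0 \<le> t \<Longrightarrow> (\<phi> \<longlongrightarrow> \<phi> t) (at_right t)"
    and bounded: "\<And>t. \<bar>\<phi> t\<bar> \<le> b"
  shows "(\<lambda>N. T / real (Suc N) * (\<Sum>i = 1..Suc N. \<phi> (real i * (T / real (Suc N)))))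
           \<longlonglongrightarrow> (LINT s:{0..T}|lborel. \<phi> s)"
proof -
  define h where "h N = T / real (Suc N)" for N
  \<comment> \<open>The isolated value at \<open>0\<close>, which has no cell to its left, makes the convergence hold
     everywhere; it does not change the integral.\<close>
  define \<psi> where "\<psi> N s = indicator {0} s * \<phi> 0
      + (\<Sum>i = 1..Suc N. indicator {real (i - 1) * h N <.. real i * h N} s * \<phi> (real i * h N))" for N s
  have h_pos: "0 < h N" for N using T by (simp add: h_def)
  have hN: "real (Suc N) * h N = T" for N by (simp add: h_def)
  have \<psi>_inside: "\<psi> N s = \<phi> (of_int \<lceil>s / h N\<rceil> * h N)" if s: "0 < s" "s \<le> T" for N s
  proof -
    define j where "j = nat \<lceil>s / h N\<rceil>"
    have "0 < s / h N" using s h_pos[of N] by simp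
    then have "0 < \<lceil>s / h N\<rceil>" by (simp only: zero_less_ceiling)
    then have ceil: "\<lceil>s / h N\<rceil> = int j" "1 \<le> j" unfolding j_def by linarith+
    have jb: "real j - 1 < s / h N" "s / h N \<le> real j"
      using ceil by linarith+
    have "s / h N \<le> real (Suc N)"
      using s hN[of N] h_pos[of N] by (simp add: pos_divide_le_eq)
    then have j_le: "j \<le> Suc N"
      using jb by linarith
    have mem: "s \<in> {real (i - 1) * h N <.. real i * h N} \<longleftrightarrow> i = j" if "1 \<le> i" for i
    proof -
      have "s \<in> {real (i - 1) * h N <.. real i * h N} \<longleftrightarrow> real i - 1 < s / h N \<and> s / h N \<le> real i"
        using that h_pos[of N] by (simp add: pos_less_divide_eq pos_divide_le_eq of_nat_diff)
      also have "\<dots> \<longleftrightarrow> i = j" using jb by auto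
      finally show ?thesis .
    qed
    have "\<psi> N s = (\<Sum>i = 1..Suc N. if i = j then \<phi> (real i * h N) else 0)"
      unfolding \<psi>_def using s mem by (auto simp: indicator_def simp del: greaterThanAtMost_iff intro!: sum.cong)
    also have "\<dots> = \<phi> (real j * h N)" using ceil j_le by (simp add: sum.delta)
    finally show ?thesis by (simp add: ceil)
  qed
  have \<psi>_outside: "\<psi> N s = 0" if "s < 0 \<or> T < s" for N s
  proof -
    have "s \<notin> {real (i - 1) * h N <.. real i * h N}" if "1 \<le> i" "i \<le> Suc N" for i
    proof
      assume *: "s \<in> {real (i - 1) * h N <.. real i * h N}"
      have "real i * h N \<le> real (Suc N) * h N"
        using that h_pos[of N] by (intro mult_right_mono) auto
      moreover have "0 \<le> real (i - 1) * h N" using h_pos[of N] by simp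
      ultimately show False using * \<open>s < 0 \<or> T < s\<close> hN[of N] by auto
    qed
    then show ?thesis using \<open>s < 0 \<or> T < s\<close> T by (auto simp: \<psi>_def intro!: sum.neutral)
  qed
  have \<psi>_zero: "\<psi> N 0 = \<phi> 0" for N
  proof -
    have "0 \<notin> {real (i - 1) * h N <.. real i * h N}" for i
      using h_pos[of N] by (auto simp: not_less)
    then show ?thesis by (simp add: \<psi>_def)
  qed
  have h_lim: "h \<longlonglongrightarrow> 0"
    unfolding h_def using tendsto_mult[OF tendsto_const[of T] LIMSEQ_inverse_real_of_nat]
    by (simp add: divide_inverse)
  have pointwise: "(\<lambda>N. \<psi> N s) \<longlonglongrightarrow> indicator {0..T} s * \<phi> s" for s
  proof -
    consider "s < 0 \<or> T < s" | "s = 0" | "0 < s \<and> s \<le> T" by linarith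
    then show ?thesis
    proof cases
      case 1
      then show ?thesis using \<psi>_outside[OF 1] by auto
    next
      case 2
      then show ?thesis using \<psi>_zero T by auto
    next
      case 3
      define c where "c N = of_int \<lceil>s / h N\<rceil> * h N" for N
      have c_ge: "s \<le> c N" for N
        unfolding c_def using pos_divide_le_eq[OF h_pos[of N]] le_of_int_ceiling by blast
      have c_le: "c N \<le> s + h N" for N
      proof -
        have "of_int \<lceil>s / h N\<rceil> * h N \<le> (s / h N + 1) * h N"
          using h_pos[of N] of_int_ceiling_le_add_one[of "s / h N"] by (intro mult_right_mono) auto
        also have "(s / h N + 1) * h N = s + h N"
          using h_pos[of N] by (simp add: distrib_right)
        finally show ?thesis by (simp add: c_def)
      qed
      have "c \<longlonglongrightarrow> s"
        by (rule tendsto_sandwich[of "\<lambda>_. s" c sequentially "\<lambda>N. s + h N"])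
          (use c_ge c_le tendsto_add[OF tendsto_const[of s] h_lim] in auto)
      moreover have "continuous (at s within {s..}) \<phi>"
        using right_cont[of s] 3 by (simp add: continuous_within at_within_Ici_at_right)
      ultimately have "(\<lambda>N. \<phi> (c N)) \<longlonglongrightarrow> \<phi> s"
        using continuous_within_tendsto_compose'[of s "{s..}" \<phi> c sequentially] c_ge by simp
      then show ?thesis using 3 \<psi>_inside by (simp add: c_def)
    qed
  qed
  have \<psi>_bound: "\<bar>\<psi> N s\<bar> \<le> b * indicator {0..T} s" for N s
    using bounded \<psi>_inside[of s N] \<psi>_outside[of s N] \<psi>_zero[of N]
    by (cases "s = 0"; cases "0 < s \<and> s \<le> T") (force simp: indicator_def not_less not_le)+
  have [measurable]: "\<psi> N \<in> borel_measurable lborel" for N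
    unfolding \<psi>_def by measurable
  have meas: "(\<lambda>s. indicator {0..T} s * \<phi> s) \<in> borel_measurable lborel"
    by (rule borel_measurable_LIMSEQ_real[of _ \<psi>]) (use pointwise in auto)
  have "(\<lambda>N. integral\<^sup>L lborel (\<psi> N)) \<longlonglongrightarrow> (\<integral>s. indicator {0..T} s * \<phi> s \<partial>lborel)"
    by (rule integral_dominated_convergence[where w = "\<lambda>s. b * indicator {0..T} s"])
      (use meas pointwise \<psi>_bound T in \<open>auto intro!: integrable_real_indicator\<close>)
  moreover have "integral\<^sup>L lborel (\<psi> N) = h N * (\<Sum>i = 1..Suc N. \<phi> (real i * h N))" for N
  proof -
    have point: "has_bochner_integral lborel (\<lambda>s. indicator {0::real} s * \<phi> 0) (0 * \<phi> 0)"
    proof (rule has_bochner_integral_mult_left)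
      show "has_bochner_integral lborel (indicator {0::real}) (0::real)"
        using has_bochner_integral_real_indicator[of "{0::real}" lborel] by simp
    qed
    have cell: "has_bochner_integral lborel
        (\<lambda>s. indicator {real (i - 1) * h N <.. real i * h N} s * \<phi> (real i * h N)) (h N * \<phi> (real i * h N))"
      if i: "i \<in> {1..Suc N}" for i
    proof (rule has_bochner_integral_mult_left)
      have "real (i - 1) * h N \<le> real i * h N"
        using h_pos[of N] by (intro mult_right_mono) auto
      moreover have "real i * h N - real (i - 1) * h N = h N"
        using i by (simp add: of_nat_diff algebra_simps)
      ultimately have "measure lborel {real (i - 1) * h N <.. real i * h N} = h N"
        and "emeasure lborel {real (i - 1) * h N <.. real i * h N} < \<infinity>" by simp_all
      then show "has_bochner_integral lborel (indicator {real (i - 1) * h N <.. real i * h N}) (h N)"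
        using has_bochner_integral_real_indicator[of "{real (i - 1) * h N <.. real i * h N}" lborel] by simp
    qed
    have "has_bochner_integral lborel (\<psi> N) (0 * \<phi> 0 + (\<Sum>i = 1..Suc N. h N * \<phi> (real i * h N)))"
      unfolding \<psi>_def by (intro has_bochner_integral_add has_bochner_integral_sum point cell)
    then show ?thesis
      by (simp only: has_bochner_integral_integral_eq mult_zero_left add_0_left sum_distrib_left)
  qed
  ultimately show ?thesis
    by (simp add: h_def set_lebesgue_integral_def del: sum.cl_ivl_Suc of_nat_Suc)
qed

section \<open>Near-isometries and their iterates\<close>

lemma quadratic_form_le_max_entry:
  fixes R :: "'a \<Rightarrow> 'a \<Rightarrow> real"
  assumes "finite S" and R: "\<And>y z. y \<in> S \<Longrightarrow> z \<in> S \<Longrightarrow> \<bar>R y z\<bar> \<le> r"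
  shows "(\<Sum>y\<in>S. \<Sum>z\<in>S. R y z * f y * f z) \<le> r * real (card S) * (\<Sum>y\<in>S. (f y)\<^sup>2)"
proof -
  have "(\<Sum>y\<in>S. \<Sum>z\<in>S. R y z * f y * f z) \<le> (\<Sum>y\<in>S. \<Sum>z\<in>S. r * ((f y)\<^sup>2 + (f z)\<^sup>2) / 2)"
  proof (intro sum_mono)
    fix y z assume yz: "y \<in> S" "z \<in> S"
    have "R y z * f y * f z \<le> \<bar>R y z\<bar> * \<bar>f y * f z\<bar>"
      by (metis abs_ge_self abs_mult mult.assoc)
    also have "\<dots> \<le> r * \<bar>f y * f z\<bar>"
      by (intro mult_right_mono R yz) simp
    also have "\<dots> \<le> r * (((f y)\<^sup>2 + (f z)\<^sup>2) / 2)"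
    proof (rule mult_left_mono)
      show "\<bar>f y * f z\<bar> \<le> ((f y)\<^sup>2 + (f z)\<^sup>2) / 2"
        using sum_squares_bound[of "\<bar>f y\<bar>" "\<bar>f z\<bar>"] by (simp add: abs_mult)
      show "0 \<le> r" using R[OF yz] by linarith
    qed
    finally show "R y z * f y * f z \<le> r * ((f y)\<^sup>2 + (f z)\<^sup>2) / 2" by simp
  qed
  also have "\<dots> = r * real (card S) * (\<Sum>y\<in>S. (f y)\<^sup>2)"
    by (simp add: sum.distrib add_divide_distrib distrib_left
        flip: sum_distrib_left sum_divide_distrib)
  finally show ?thesis .
qed

text \<open>
  Expanding \<open>|(1 + h D) f|\<^sup>2\<close> with \<open>D = (K h - 1) / h\<close>, the coefficient of \<open>h\<close> is a quadratic form
  whose matrix \<open>R h\<close> tends to \<open>G + G\<^sup>T\<close>, and that limit is nonpositive.  Entrywise convergence suffices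
  for a bound uniform in \<open>f\<close> because \<open>S\<close> is finite.
\<close>

lemma eventually_near_isometry:
  fixes K :: "real \<Rightarrow> 'a \<Rightarrow> 'a \<Rightarrow> real"
  assumes S: "finite S" and \<epsilon>: "0 < \<epsilon>"
    and deriv: "\<And>x y. x \<in> S \<Longrightarrow> y \<in> S \<Longrightarrow>
        ((\<lambda>h. (K h x y - (if x = y then 1 else 0)) / h) \<longlongrightarrow> G x y) (at_right 0)"
    and nonpos: "\<And>f. (\<Sum>x\<in>S. \<Sum>y\<in>S. G x y * f x * f y) \<le> 0"
  shows "eventually (\<lambda>h. \<forall>f. (\<Sum>x\<in>S. (\<Sum>y\<in>S. K h x y * f y)\<^sup>2) \<le> (1 + \<epsilon> * h) * (\<Sum>x\<in>S. (f x)\<^sup>2))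
           (at_right 0)"
proof -
  define D where "D h x y = (K h x y - (if x = y then 1 else 0)) / h" for h x y
  define R where "R h y z = D h y z + D h z y + h * (\<Sum>x\<in>S. D h x y * D h x z)" for h y z
  define r where "r = \<epsilon> / (real (card S) + 1)"
  have r: "0 < r" "r * real (card S) \<le> \<epsilon>" using \<epsilon> by (auto simp: r_def field_simps)
  have "((\<lambda>h. R h y z) \<longlongrightarrow> G y z + G z y + 0 * (\<Sum>x\<in>S. G x y * G x z)) (at_right 0)"
    if "y \<in> S" "z \<in> S" for y z
    unfolding R_def D_def
    by (intro tendsto_intros deriv that) auto
  then have "eventually (\<lambda>h. \<bar>R h y z - (G y z + G z y)\<bar> < r) (at_right 0)"
    if "y \<in> S" "z \<in> S" for y z
    using tendstoD[of "\<lambda>h. R h y z" "G y z + G z y" "at_right 0" r] that r by (simp add: dist_real_def)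
  then have "eventually (\<lambda>h. \<forall>y\<in>S. \<forall>z\<in>S. \<bar>R h y z - (G y z + G z y)\<bar> < r) (at_right 0)"
    using S by (simp add: eventually_ball_finite)
  moreover have "eventually (\<lambda>h. 0 < h) (at_right (0::real))"
    by (simp add: eventually_at_right_less)
  ultimately show ?thesis
  proof eventually_elim
    case (elim h)
    show ?case
    proof
      fix f :: "'a \<Rightarrow> real"
      have step: "(\<Sum>y\<in>S. K h x y * f y) = f x + h * (\<Sum>y\<in>S. D h x y * f y)" if "x \<in> S" for x
      proof -
        have "K h x y = (if x = y then 1 else 0) + h * D h x y" for y
          using elim by (simp add: D_def)
        then have "(\<Sum>y\<in>S. K h x y * f y)
            = (\<Sum>y\<in>S. (if x = y then f y else 0) + h * (D h x y * f y))"
          by (intro sum.cong) (auto simp: algebra_simps)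
        also have "\<dots> = f x + h * (\<Sum>y\<in>S. D h x y * f y)"
          using S that by (simp add: sum.distrib sum_distrib_left)
        finally show ?thesis .
      qed
      have cross: "(\<Sum>x\<in>S. 2 * f x * (\<Sum>y\<in>S. D h x y * f y))
          = (\<Sum>y\<in>S. \<Sum>z\<in>S. (D h y z + D h z y) * f y * f z)"
      proof -
        have "(\<Sum>y\<in>S. \<Sum>z\<in>S. D h z y * f y * f z) = (\<Sum>y\<in>S. \<Sum>z\<in>S. D h y z * f y * f z)"
          by (subst sum.swap) (simp add: mult_ac)
        moreover have "(\<Sum>x\<in>S. 2 * f x * (\<Sum>y\<in>S. D h x y * f y))
            = 2 * (\<Sum>y\<in>S. \<Sum>z\<in>S. D h y z * f y * f z)"
          by (simp add: sum_distrib_left mult_ac)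
        ultimately show ?thesis by (simp add: distrib_right sum.distrib)
      qed
      have square: "(\<Sum>x\<in>S. (\<Sum>y\<in>S. D h x y * f y)\<^sup>2)
          = (\<Sum>y\<in>S. \<Sum>z\<in>S. (\<Sum>x\<in>S. D h x y * D h x z) * f y * f z)"
      proof -
        have "(\<Sum>x\<in>S. (\<Sum>y\<in>S. D h x y * f y)\<^sup>2)
            = (\<Sum>x\<in>S. \<Sum>y\<in>S. \<Sum>z\<in>S. D h x y * D h x z * f y * f z)"
          by (simp add: power2_eq_square sum_product mult_ac)
        also have "\<dots> = (\<Sum>y\<in>S. \<Sum>x\<in>S. \<Sum>z\<in>S. D h x y * D h x z * f y * f z)"
          by (rule sum.swap)
        also have "\<dots> = (\<Sum>y\<in>S. \<Sum>z\<in>S. \<Sum>x\<in>S. D h x y * D h x z * f y * f z)"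
          by (intro sum.cong refl sum.swap)
        finally show ?thesis by (simp add: sum_distrib_right)
      qed
      have "(\<Sum>x\<in>S. (\<Sum>y\<in>S. K h x y * f y)\<^sup>2)
          = (\<Sum>x\<in>S. (f x + h * (\<Sum>y\<in>S. D h x y * f y))\<^sup>2)"
        by (intro sum.cong) (auto simp: step)
      also have "\<dots> = (\<Sum>x\<in>S. (f x)\<^sup>2) + h * (\<Sum>x\<in>S. 2 * f x * (\<Sum>y\<in>S. D h x y * f y))
          + h * (h * (\<Sum>x\<in>S. (\<Sum>y\<in>S. D h x y * f y)\<^sup>2))"
      proof -
        have "(f x + h * v)\<^sup>2 = (f x)\<^sup>2 + h * (2 * f x * v) + h * (h * v\<^sup>2)" for x v
          by (simp add: power2_eq_square algebra_simps)
        then show ?thesis by (simp add: sum.distrib flip: sum_distrib_left)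
      qed
      also have "\<dots> = (\<Sum>x\<in>S. (f x)\<^sup>2) + h * (\<Sum>y\<in>S. \<Sum>z\<in>S. R h y z * f y * f z)"
        unfolding cross square R_def
        by (simp add: distrib_right distrib_left sum.distrib sum_distrib_left mult_ac)
      also have "(\<Sum>y\<in>S. \<Sum>z\<in>S. R h y z * f y * f z) \<le> \<epsilon> * (\<Sum>x\<in>S. (f x)\<^sup>2)"
      proof -
        have "(\<Sum>y\<in>S. \<Sum>z\<in>S. R h y z * f y * f z)
            = (\<Sum>y\<in>S. \<Sum>z\<in>S. (R h y z - (G y z + G z y)) * f y * f z)
              + ((\<Sum>y\<in>S. \<Sum>z\<in>S. G y z * f y * f z) + (\<Sum>y\<in>S. \<Sum>z\<in>S. G z y * f y * f z))"
          by (simp add: algebra_simps flip: sum.distrib)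
        also have "(\<Sum>y\<in>S. \<Sum>z\<in>S. G z y * f y * f z) = (\<Sum>y\<in>S. \<Sum>z\<in>S. G y z * f y * f z)"
          by (subst sum.swap) (simp add: mult_ac)
        also have "(\<Sum>y\<in>S. \<Sum>z\<in>S. (R h y z - (G y z + G z y)) * f y * f z)
            \<le> r * real (card S) * (\<Sum>y\<in>S. (f y)\<^sup>2)"
          using elim by (intro quadratic_form_le_max_entry S) (auto intro: less_imp_le)
        also have "\<dots> \<le> \<epsilon> * (\<Sum>y\<in>S. (f y)\<^sup>2)"
          by (intro mult_right_mono r sum_nonneg) simp
        finally show ?thesis using nonpos[of f] by linarith
      qed
      finally show "(\<Sum>x\<in>S. (\<Sum>y\<in>S. K h x y * f y)\<^sup>2) \<le> (1 + \<epsilon> * h) * (\<Sum>x\<in>S. (f x)\<^sup>2)"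
        using elim by (simp add: algebra_simps)
    qed
  qed
qed

text \<open>
  The power \<open>K ^ m\<close> of the matrix on \<open>S \<times> S\<close>, applied to the constant function \<open>1\<close>.
\<close>

primrec kernel_iter :: "('a \<Rightarrow> 'a \<Rightarrow> real) \<Rightarrow> 'a set \<Rightarrow> nat \<Rightarrow> 'a \<Rightarrow> real" where
  "kernel_iter K S 0 = (\<lambda>x. 1)"
| "kernel_iter K S (Suc m) = (\<lambda>x. \<Sum>y\<in>S. K x y * kernel_iter K S m y)"

lemma kernel_iter_sum_squares_le:
  assumes K: "\<And>f. (\<Sum>x\<in>S. (\<Sum>y\<in>S. K x y * f y)\<^sup>2) \<le> c * (\<Sum>x\<in>S. (f x)\<^sup>2)" and c: "0 \<le> c"
  shows "(\<Sum>x\<in>S. (kernel_iter K S m x)\<^sup>2) \<le> c ^ m * real (card S)"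
proof (induction m)
  case (Suc m)
  have "(\<Sum>x\<in>S. (kernel_iter K S (Suc m) x)\<^sup>2) \<le> c * (\<Sum>x\<in>S. (kernel_iter K S m x)\<^sup>2)"
    using K[of "kernel_iter K S m"] by simp
  also have "\<dots> \<le> c * (c ^ m * real (card S))"
    using Suc c by (rule mult_left_mono)
  finally show ?case by simp
qed simp

section \<open>Ground-state potentials\<close>

text \<open>
  The potential \<open>V\<close> that makes \<open>u\<close> a ground state of \<open>A + V\<close> on \<open>S\<close>, with eigenvalue \<open>0\<close>.  It depends on \<open>u\<close>
  only up to a constant factor, so multiples of a mesh size can be given by their integer
  coefficients.
\<close>

definition ground_state_potential :: "('a \<Rightarrow> 'a \<Rightarrow> real) \<Rightarrow> 'a set \<Rightarrow> ('a \<Rightarrow> real) \<Rightarrow> 'a \<Rightarrow> real" where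
  "ground_state_potential A S u x = - (\<Sum>y\<in>S. A x y * u y) / u x"

text \<open>
  With \<open>f = u g\<close> the form equals \<open>- 1/2 \<Sum>\<^sub>x\<^sub>y A(x, y) u(x) u(y) (g(x) - g(y))\<^sup>2\<close>: the terms of \<open>V\<close> cancel the
  squares that symmetrization leaves over.  Diagonal entries of \<open>A\<close>, whatever their sign, drop out.
\<close>

lemma ground_state_form_nonpos:
  assumes S: "finite S" and sym: "\<And>x y. A x y = A y x" and off: "\<And>x y. x \<noteq> y \<Longrightarrow> 0 \<le> A x y"
    and u: "\<And>x. x \<in> S \<Longrightarrow> 0 < u x"
  shows "(\<Sum>x\<in>S. \<Sum>y\<in>S. A x y * f x * f y) + (\<Sum>x\<in>S. ground_state_potential A S u x * (f x)\<^sup>2) \<le> 0"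
proof -
  define g where "g x = f x / u x" for x
  have f: "f x = u x * g x" if "x \<in> S" for x using u[OF that] by (simp add: g_def)
  define d where "d x y = A x y * u x * u y * (g x * g y - (g x)\<^sup>2)" for x y
  have "(\<Sum>x\<in>S. \<Sum>y\<in>S. A x y * f x * f y) + (\<Sum>x\<in>S. ground_state_potential A S u x * (f x)\<^sup>2)
      = (\<Sum>x\<in>S. \<Sum>y\<in>S. d x y)"
  proof -
    have "ground_state_potential A S u x * (f x)\<^sup>2 = (\<Sum>y\<in>S. - (A x y * u x * u y * (g x)\<^sup>2))" if "x \<in> S" for x
      using u[OF that] f[OF that]
      by (simp add: ground_state_potential_def power2_eq_square sum_negf sum_distrib_left
            sum_divide_distrib mult_ac)
    then show ?thesis
      by (simp add: d_def f right_diff_distrib sum_subtractf sum_negf mult_ac)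
  qed
  moreover have "2 * (\<Sum>x\<in>S. \<Sum>y\<in>S. d x y) = (\<Sum>x\<in>S. \<Sum>y\<in>S. d x y + d y x)"
    using sum.swap[of d S S] by (simp add: sum.distrib)
  moreover have "d x y + d y x \<le> 0" if "x \<in> S" "y \<in> S" for x y
  proof (cases "x = y")
    case False
    have "d x y + d y x = - (A x y * u x * u y * (g x - g y)\<^sup>2)"
      by (simp add: d_def sym[of y x] power2_eq_square algebra_simps)
    then show ?thesis
      using off[OF False] u[OF that(1)] u[OF that(2)] by simp
  qed (simp add: d_def power2_eq_square)
  then have "(\<Sum>x\<in>S. \<Sum>y\<in>S. d x y + d y x) \<le> 0"
    by (intro sum_nonpos) auto
  ultimately show ?thesis by linarith
qed

section \<open>Rounding the local times to a finite net\<close>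

lemma eta_bounds:
  assumes S: "finite S" "S \<noteq> {}"
  shows "1 \<le> eta A S" and "\<And>x. x \<in> S \<Longrightarrow> (\<Sum>y\<in>S - {x}. \<bar>A x y\<bar>) \<le> eta A S"
proof -
  show "1 \<le> eta A S" unfolding eta_def by simp
  fix x assume x: "x \<in> S"
  have "(\<Sum>y\<in>S - {x}. \<bar>A x y\<bar>) = (\<Sum>y\<in>S - {x}. \<bar>off_diagonal A x y\<bar>)"
    by (intro sum.cong) (auto simp: off_diagonal_def)
  also have "\<dots> \<le> Max ((\<lambda>x. \<Sum>y\<in>S - {x}. \<bar>off_diagonal A x y\<bar>) ` S)"
    using S x by (intro Max_ge) auto
  also have "\<dots> \<le> eta A S" unfolding eta_def by simp
  finally show "(\<Sum>y\<in>S - {x}. \<bar>A x y\<bar>) \<le> eta A S" .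
qed

text \<open>
  The exponent lost by rounding.  A single state has no off-diagonal rates and loses nothing; this
  case is kept apart because a loss of \<open>1\<close> would give \<open>2 e\<close> per unit of \<open>\<eta> T\<close>, more than the
  \<open>sqrt (8 e)\<close> of the error term.
\<close>

definition rounding_loss :: "nat \<Rightarrow> real" where
  "rounding_loss n = (if n = 1 then 0 else sqrt (real n))"

text \<open>
  Let \<open>\<delta> = 1 / (\<eta> sqrt T)\<close> and let \<open>\<delta> k\<close> be \<open>sqrt l\<close> rounded up to a positive multiple of \<open>\<delta>\<close>.  The difference of
  the two sides is a sum over \<open>x \<noteq> y\<close> of \<open>A(x, y) sqrt (l x)\<close> times \<open>sqrt (l x) k(y) / k(x) - sqrt (l y)\<close>.
  Rounding up gives \<open>sqrt (l x) / k(x) \<le> \<delta>\<close>, so the second factor is at most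
  \<open>\<delta> k(y) - sqrt (l y) \<le> \<delta>\<close>, even where \<open>l\<close> vanishes.  Summing over \<open>y\<close> costs a factor \<open>\<eta>\<close>, and
  \<open>\<Sum>\<^sub>x sqrt (l x) \<le> sqrt (T |S|)\<close> by Cauchy-Schwarz.
\<close>

lemma dirichlet_form_rounding:
  fixes l :: "'a \<Rightarrow> real" and T :: real
  assumes S: "finite S" "S \<noteq> {}" and off: "\<And>x y. x \<noteq> y \<Longrightarrow> 0 \<le> A x y"
    and T: "0 < T" and l_nonneg: "\<And>x. x \<in> S \<Longrightarrow> 0 \<le> l x" and l_sum: "(\<Sum>x\<in>S. l x) = T"
  obtains k :: "'a \<Rightarrow> nat" where
    "k \<in> PiE S (\<lambda>_. {1..max 1 (nat \<lceil>eta A S * T\<rceil>)})"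
    "dirichlet_form A S (\<lambda>x. sqrt (l x))
      \<le> (\<Sum>x\<in>S. ground_state_potential A S (\<lambda>x. real (k x)) x * l x) + rounding_loss (card S)"
proof -
  define \<delta> where "\<delta> = 1 / (eta A S * sqrt T)"
  have eta: "1 \<le> eta A S" using eta_bounds(1)[OF S] .
  have \<delta>: "0 < \<delta>" using eta T by (simp add: \<delta>_def)
  define k where "k = (\<lambda>x\<in>S. max 1 (nat \<lceil>sqrt (l x) / \<delta>\<rceil>))"
  have k_pos: "1 \<le> k x" if "x \<in> S" for x using that by (simp add: k_def)
  have k_ge: "sqrt (l x) \<le> \<delta> * real (k x)" if "x \<in> S" for x
  proof -
    have "sqrt (l x) / \<delta> \<le> real (k x)"
      using that unfolding k_def by simp linarith
    then show ?thesis using \<delta> by (simp add: pos_divide_le_eq mult.commute)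
  qed
  have k_le: "\<delta> * real (k x) \<le> sqrt (l x) + \<delta>" if "x \<in> S" for x
  proof -
    have "0 \<le> sqrt (l x) / \<delta>" using l_nonneg[OF that] \<delta> by simp
    then have "real (k x) \<le> sqrt (l x) / \<delta> + 1"
      using that unfolding k_def by simp linarith
    then have "\<delta> * real (k x) \<le> \<delta> * (sqrt (l x) / \<delta> + 1)" using \<delta> by (intro mult_left_mono) auto
    then show ?thesis using \<delta> by (simp add: distrib_left)
  qed
  have "k \<in> PiE S (\<lambda>_. {1..max 1 (nat \<lceil>eta A S * T\<rceil>)})"
  proof (rule PiE_I)
    fix x assume x: "x \<in> S"
    have "l x \<le> T" using x S l_nonneg l_sum member_le_sum[of x S l] by auto
    then have "sqrt (l x) \<le> sqrt T" by simp
    then have "sqrt (l x) / \<delta> \<le> sqrt T / \<delta>" using \<delta> by (intro divide_right_mono) auto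
    also have "sqrt T / \<delta> = eta A S * T"
      using T by (simp add: \<delta>_def mult_ac)
    finally have "nat \<lceil>sqrt (l x) / \<delta>\<rceil> \<le> nat \<lceil>eta A S * T\<rceil>"
      by (intro nat_mono ceiling_mono)
    then show "k x \<in> {1..max 1 (nat \<lceil>eta A S * T\<rceil>)}" using x by (auto simp: k_def)
  qed (simp add: k_def)
  moreover have "dirichlet_form A S (\<lambda>x. sqrt (l x))
      - (\<Sum>x\<in>S. ground_state_potential A S (\<lambda>x. real (k x)) x * l x) \<le> rounding_loss (card S)"
  proof -
    define w where "w x y = sqrt (l x) * real (k y) / real (k x) - sqrt (l y)" for x y
    have "dirichlet_form A S (\<lambda>x. sqrt (l x))
      - (\<Sum>x\<in>S. ground_state_potential A S (\<lambda>x. real (k x)) x * l x)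
      = (\<Sum>x\<in>S. (\<Sum>y\<in>S. A x y * sqrt (l x) * w x y))"
    proof -
      have "ground_state_potential A S (\<lambda>x. real (k x)) x * l x
          = - (\<Sum>y\<in>S. A x y * sqrt (l x) * (sqrt (l x) * real (k y) / real (k x)))" if "x \<in> S" for x
      proof -
        have "l x = sqrt (l x) * sqrt (l x)" using l_nonneg[OF that] by simp
        then show ?thesis
          by (simp add: ground_state_potential_def sum_divide_distrib sum_distrib_left mult_ac)
      qed
      then show ?thesis
        by (simp add: dirichlet_form_def w_def right_diff_distrib sum_subtractf sum_negf mult_ac)
    qed
    also have "\<dots> \<le> (\<Sum>x\<in>S. (\<Sum>y\<in>S - {x}. \<bar>A x y\<bar>) * (sqrt (l x) * \<delta>))"
    proof (rule sum_mono)
      fix x assume x: "x \<in> S"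
      have "w x x = 0" using k_pos[OF x] by (simp add: w_def)
      then have "(\<Sum>y\<in>S. A x y * sqrt (l x) * w x y) = (\<Sum>y\<in>S - {x}. A x y * sqrt (l x) * w x y)"
        using S x by (subst sum.remove[of S x]) auto
      also have "\<dots> \<le> (\<Sum>y\<in>S - {x}. \<bar>A x y\<bar> * (sqrt (l x) * \<delta>))"
      proof (rule sum_mono)
        fix y assume y: "y \<in> S - {x}"
        have "sqrt (l x) * real (k y) / real (k x) = (sqrt (l x) / real (k x)) * real (k y)" by simp
        also have "\<dots> \<le> \<delta> * real (k y)"
          using k_ge[OF x] k_pos[OF x] by (intro mult_right_mono) (auto simp: pos_divide_le_eq)
        also have "\<dots> \<le> sqrt (l y) + \<delta>" using k_le y by simp
        finally have "w x y \<le> \<delta>" by (simp add: w_def)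
        moreover have "0 \<le> A x y" using off y by auto
        ultimately show "A x y * sqrt (l x) * w x y \<le> \<bar>A x y\<bar> * (sqrt (l x) * \<delta>)"
          using l_nonneg[OF x] by (simp add: mult.assoc mult_left_mono)
      qed
      finally show "(\<Sum>y\<in>S. A x y * sqrt (l x) * w x y) \<le> (\<Sum>y\<in>S - {x}. \<bar>A x y\<bar>) * (sqrt (l x) * \<delta>)"
        by (simp add: sum_distrib_right)
    qed
    also have "\<dots> \<le> rounding_loss (card S)"
    proof (cases "card S = 1")
      case True
      then obtain x where "S = {x}" by (auto simp: card_Suc_eq)
      then show ?thesis by (simp add: rounding_loss_def)
    next
      case False
      have "(\<Sum>x\<in>S. (\<Sum>y\<in>S - {x}. \<bar>A x y\<bar>) * (sqrt (l x) * \<delta>)) \<le> (\<Sum>x\<in>S. eta A S * (sqrt (l x) * \<delta>))"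
        using \<delta> l_nonneg by (intro sum_mono mult_right_mono eta_bounds S) auto
      also have "\<dots> = (\<Sum>x\<in>S. sqrt (l x)) / sqrt T"
        using eta by (simp add: \<delta>_def sum_divide_distrib)
      also have "\<dots> \<le> sqrt (T * real (card S)) / sqrt T"
      proof (rule divide_right_mono)
        have "(\<Sum>x\<in>S. sqrt (l x))\<^sup>2 \<le> (\<Sum>x\<in>S. (sqrt (l x))\<^sup>2) * real (card S)"
          by (rule sum_squared_le_sum_of_squares)
        also have "\<dots> = T * real (card S)" using l_nonneg l_sum by simp
        finally show "(\<Sum>x\<in>S. sqrt (l x)) \<le> sqrt (T * real (card S))" by (rule real_le_rsqrt)
      qed (use T in simp)
      also have "\<dots> = rounding_loss (card S)"
        using False T by (simp add: rounding_loss_def real_sqrt_mult)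
      finally show ?thesis .
    qed
    finally show ?thesis .
  qed
  ultimately show thesis using that by force
qed

text \<open>
  The left side is the rounding factor times the size of the net times the Feynman-Kac bound.
  Since \<open>\<eta> T \<ge> 1\<close>, the net has at most \<open>(2 \<eta> T) ^ n\<close> points, and \<open>sqrt (8 e) = 2 sqrt (2 e)\<close>, so it remains to
  absorb \<open>exp (sqrt n)\<close> in \<open>(2 e) ^ (n / 2)\<close>: this holds for \<open>n \<ge> 2\<close> because \<open>2 sqrt n \<le> n + 1\<close> and
  \<open>1 \<le> n ln 2\<close>.
\<close>

lemma entropy_le_error_term:
  assumes S: "finite S" "S \<noteq> {}" and T: "1 \<le> T"
  shows "exp (rounding_loss (card S)) * (real (max 1 (nat \<lceil>eta A S * T\<rceil>)) ^ card S * sqrt (real (card S)))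
      \<le> exp (error_term A S T)"
proof -
  define n where "n = card S"
  have n: "1 \<le> n" using S by (simp add: n_def Suc_le_eq card_gt_0_iff)
  define q where "q = eta A S * T"
  have q: "1 \<le> q" using eta_bounds(1)[OF S, of A] T mult_mono[of 1 "eta A S" 1 T] by (simp add: q_def)
  have mesh: "real (max 1 (nat \<lceil>q\<rceil>)) \<le> 2 * q"
    using q by simp linarith
  have loss: "rounding_loss n \<le> real n * ln (sqrt (2 * exp 1))"
  proof (cases "n = 1")
    case True
    have "1 \<le> sqrt (2 * exp 1)" using exp_ge_add_one_self[of 1] by simp
    then show ?thesis using True by (simp add: rounding_loss_def ln_ge_zero)
  next
    case False
    have "real n * ln (sqrt (2 * exp 1 :: real)) = real n * ln 2 / 2 + real n / 2"
      by (simp add: ln_sqrt ln_mult algebra_simps add_divide_distrib)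
    moreover have "1 \<le> real n * ln 2"
    proof -
      have "exp 1 \<le> (2::real)\<^sup>2" using e_less_272 by simp
      then have "1 \<le> ln ((2::real)\<^sup>2)" by (subst ln_ge_iff) auto
      then have "1 \<le> 2 * ln (2::real)" by (simp only: ln_realpow)
      also have "\<dots> \<le> real n * ln 2" using n False by (intro mult_right_mono) auto
      finally show ?thesis .
    qed
    moreover have "2 * sqrt (real n) \<le> real n + 1"
      using sum_squares_bound[of "sqrt (real n)" 1] by simp
    ultimately show ?thesis using False by (simp only: rounding_loss_def if_False)
  qed
  have "exp (rounding_loss n) * (real (max 1 (nat \<lceil>q\<rceil>)) ^ n * sqrt (real n))
      \<le> exp (real n * ln (sqrt (2 * exp 1))) * ((2 * q) ^ n * real n)"
  proof (intro mult_mono power_mono)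
    have "sqrt (real n) \<le> sqrt ((real n)\<^sup>2)"
      using n by (intro real_sqrt_le_mono) (simp add: power2_eq_square)
    then show "sqrt (real n) \<le> real n" by simp
  qed (use loss mesh q in auto)
  also have "\<dots> = exp (real n * ln (sqrt (2 * exp 1)) + real n * ln (2 * q) + ln (real n))"
    using q n by (simp add: exp_add flip: ln_realpow)
  also have "real n * ln (sqrt (2 * exp 1)) + real n * ln (2 * q) = real n * ln (q * sqrt (8 * exp 1))"
  proof -
    have "sqrt (8 * exp 1) = 2 * sqrt (2 * exp (1::real))"
      using real_sqrt_mult[of 4 "2 * exp 1"] by simp
    then show ?thesis using q by (simp add: ln_mult distrib_left)
  qed
  also have "exp (real n * ln (q * sqrt (8 * exp 1)) + ln (real n)) \<le> exp (error_term A S T)"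
    using T by (simp add: error_term_def n_def q_def mult_ac)
  finally show ?thesis by (simp add: n_def q_def)
qed

section \<open>Expectations along a time grid\<close>

context continuous_time_markov_chain
begin

definition transition :: "real \<Rightarrow> 'a \<Rightarrow> 'a \<Rightarrow> real" where
  "transition h x y = measure (P x) {\<omega> \<in> space \<Omega>. X h \<omega> = y}"

lemma space_P: "space (P a) = space \<Omega>"
  using sets_P by (rule sets_eq_imp_space_eq)

lemma measurable_X_P: "0 \<le> t \<Longrightarrow> X t \<in> measurable (P a) (count_space UNIV)"
  using measurable_X measurable_cong_sets[OF sets_P refl] by blast

lemma cylinder_sets: "0 \<le> h \<Longrightarrow> {\<omega> \<in> space \<Omega>. \<forall>i\<le>k. X (real i * h) \<omega> = x i} \<in> sets (P a)"
proof -
  assume "0 \<le> h"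
  then have [measurable]: "X (real i * h) \<in> measurable (P a) (count_space UNIV)" for i
    by (intro measurable_X_P) simp
  have "{\<omega> \<in> space (P a). \<forall>i\<in>{..k}. X (real i * h) \<omega> = x i} \<in> sets (P a)"
    by measurable
  then show ?thesis by (simp only: space_P Ball_def atMost_iff)
qed

text \<open>
  The Markov property is given for cylinder events, so the induction on the number \<open>m\<close> of remaining
  steps carries an arbitrary prefix of fixed states: splitting according to the next state extends
  the prefix by one and contributes one factor of the transition matrix.
\<close>

lemma cylinder_expectation:
  assumes S: "finite S" and h: "0 \<le> h" and g: "\<And>y. 0 \<le> g y"
  shows "(\<integral>\<^sup>+ \<omega>. ennreal (indicator {\<omega> \<in> space \<Omega>. \<forall>i\<le>k. X (real i * h) \<omega> = x i} \<omega> *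
            (\<Prod>i = Suc k..k + m. indicator S (X (real i * h) \<omega>) * g (X (real i * h) \<omega>))) \<partial>P a)
       = ennreal (measure (P a) {\<omega> \<in> space \<Omega>. \<forall>i\<le>k. X (real i * h) \<omega> = x i} *
            kernel_iter (\<lambda>x y. transition h x y * g y) S m (x k))"
proof (induction m arbitrary: k x)
  interpret prob_space "P a" by (rule prob_space_P)
  case 0
  define C where "C = {\<omega> \<in> space \<Omega>. \<forall>i\<le>k. X (real i * h) \<omega> = x i}"
  have "C \<in> sets (P a)" unfolding C_def by (rule cylinder_sets[OF h])
  then show ?case
    unfolding C_def[symmetric] by (simp add: ennreal_indicator emeasure_eq_measure)
next
  interpret prob_space "P a" by (rule prob_space_P)
  case (Suc m)
  define C where "C = {\<omega> \<in> space \<Omega>. \<forall>i\<le>k. X (real i * h) \<omega> = x i}"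
  define C' where "C' y = {\<omega> \<in> space \<Omega>. \<forall>i\<le>Suc k. X (real i * h) \<omega> = (x(Suc k := y)) i}" for y
  define R where "R \<omega> = (\<Prod>i = Suc (Suc k)..Suc k + m. indicator S (X (real i * h) \<omega>) * g (X (real i * h) \<omega>))" for \<omega>
  let ?K = "\<lambda>x y. transition h x y * g y"
  have C'_eq: "C' y = {\<omega> \<in> space \<Omega>. (\<forall>i\<le>k. X (real i * h) \<omega> = x i) \<and> X (real k * h + h) \<omega> = y}" for y
    by (auto simp: C'_def le_Suc_eq algebra_simps)
  have C'_prob: "measure (P a) (C' y) = measure (P a) C * transition h (x k) y" for y
    unfolding C'_eq C_def transition_def
    by (rule markov_property[where t = "\<lambda>i. real i * h"])
      (use h in \<open>auto intro!: mono_onI mult_right_mono\<close>)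
  have split: "indicator C \<omega> * (\<Prod>i = Suc k..k + Suc m. indicator S (X (real i * h) \<omega>) * g (X (real i * h) \<omega>))
      = (\<Sum>y\<in>S. g y * (indicator (C' y) \<omega> * R \<omega>))" if "\<omega> \<in> space \<Omega>" for \<omega>
  proof -
    define Y where "Y = X (real (Suc k) * h) \<omega>"
    have "indicator (C' y) \<omega> = indicator C \<omega> * (if Y = y then 1 else 0 :: real)" for y
      using that by (auto simp: C'_eq C_def Y_def indicator_def algebra_simps)
    then have "(\<Sum>y\<in>S. g y * (indicator (C' y) \<omega> * R \<omega>))
        = (\<Sum>y\<in>S. if Y = y then g y * (indicator C \<omega> * R \<omega>) else 0)"
      by (intro sum.cong) auto
    also have "\<dots> = indicator S Y * g Y * (indicator C \<omega> * R \<omega>)"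
      using S by (simp add: indicator_def)
    also have "\<dots> = indicator C \<omega> * (\<Prod>i = Suc k..k + Suc m. indicator S (X (real i * h) \<omega>) * g (X (real i * h) \<omega>))"
      by (subst prod.atLeast_Suc_atMost) (auto simp: R_def Y_def)
    finally show ?thesis by simp
  qed
  have [measurable]: "C' y \<in> sets (P a)" for y
    unfolding C'_def by (rule cylinder_sets[OF h])
  have [measurable]: "X (real i * h) \<in> measurable (P a) (count_space UNIV)" for i
    using h by (intro measurable_X_P) simp
  have [measurable]: "(\<lambda>\<omega>. R \<omega>) \<in> borel_measurable (P a)"
    unfolding R_def by measurable
  have R: "0 \<le> R \<omega>" for \<omega> unfolding R_def by (intro prod_nonneg) (auto simp: g)
  have K: "0 \<le> kernel_iter ?K S m y" for y
    by (induction m arbitrary: y) (auto intro!: sum_nonneg mult_nonneg_nonneg g simp: transition_def)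
  have "(\<integral>\<^sup>+ \<omega>. ennreal (indicator C \<omega> *
            (\<Prod>i = Suc k..k + Suc m. indicator S (X (real i * h) \<omega>) * g (X (real i * h) \<omega>))) \<partial>P a)
      = (\<integral>\<^sup>+ \<omega>. (\<Sum>y\<in>S. ennreal (g y) * ennreal (indicator (C' y) \<omega> * R \<omega>)) \<partial>P a)"
  proof (rule nn_integral_cong)
    fix \<omega> assume "\<omega> \<in> space (P a)"
    then have "\<omega> \<in> space \<Omega>" by (simp add: space_P)
    from split[OF this]
    show "ennreal (indicator C \<omega> *
            (\<Prod>i = Suc k..k + Suc m. indicator S (X (real i * h) \<omega>) * g (X (real i * h) \<omega>)))
        = (\<Sum>y\<in>S. ennreal (g y) * ennreal (indicator (C' y) \<omega> * R \<omega>))"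
      using g R by (simp only:) (simp add: ennreal_mult[symmetric] sum_ennreal)
  qed
  also have "\<dots> = (\<Sum>y\<in>S. ennreal (g y) * (\<integral>\<^sup>+ \<omega>. ennreal (indicator (C' y) \<omega> * R \<omega>) \<partial>P a))"
    by (subst nn_integral_sum) (auto simp: nn_integral_cmult)
  also have "\<dots> = (\<Sum>y\<in>S. ennreal (g y) * ennreal (measure (P a) (C' y) * kernel_iter ?K S m y))"
    using Suc.IH[of "Suc k" "x(Suc k := y)" for y] unfolding C'_def R_def by simp
  also have "\<dots> = (\<Sum>y\<in>S. ennreal (measure (P a) C * (transition h (x k) y * g y * kernel_iter ?K S m y)))"
    using g K by (intro sum.cong refl) (simp add: C'_prob ennreal_mult[symmetric] transition_def mult_ac)
  also have "\<dots> = ennreal (measure (P a) C * kernel_iter ?K S (Suc m) (x k))"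
    using g K by (subst sum_ennreal) (auto simp: transition_def sum_distrib_left)
  finally show ?case unfolding C_def .
qed

lemma grid_expectation:
  assumes S: "finite S" and h: "0 \<le> h" and g: "\<And>y. 0 \<le> g y"
  shows "(\<integral>\<^sup>+ \<omega>. ennreal (\<Prod>i = 1..m. indicator S (X (real i * h) \<omega>) * g (X (real i * h) \<omega>)) \<partial>P a)
       = ennreal (kernel_iter (\<lambda>x y. transition h x y * g y) S m a)"
proof -
  interpret prob_space "P a" by (rule prob_space_P)
  define C where "C = {\<omega> \<in> space \<Omega>. \<forall>i\<le>(0::nat). X (real i * h) \<omega> = a}"
  have C_sets: "C \<in> sets (P a)"
    unfolding C_def by (rule cylinder_sets[OF h])
  \<comment> \<open>The initial state is almost surely \<open>a\<close>, so the prefix of length one may be inserted for free.\<close>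
  have AE_C: "AE \<omega> in P a. \<omega> \<in> C"
    using start[of a] AE_space[of "P a"] by eventually_elim (simp add: space_P C_def)
  then have "measure (P a) C = 1"
    using C_sets by (simp add: prob_eq_1)
  moreover have "(\<integral>\<^sup>+ \<omega>. ennreal (\<Prod>i = 1..m. indicator S (X (real i * h) \<omega>) * g (X (real i * h) \<omega>)) \<partial>P a)
      = (\<integral>\<^sup>+ \<omega>. ennreal (indicator C \<omega> *
          (\<Prod>i = Suc 0..0 + m. indicator S (X (real i * h) \<omega>) * g (X (real i * h) \<omega>))) \<partial>P a)"
    by (rule nn_integral_cong_AE) (use AE_C in eventually_elim, simp)
  ultimately show ?thesis
    using cylinder_expectation[OF S h g, where k = 0 and x = "\<lambda>_. a" and m = m and a = a]
    unfolding C_def[symmetric] by simp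
qed

section \<open>Local times as limits of grid sums\<close>

lemma occupation_sums_tendsto_local_time:
  assumes T: "0 < T" and \<omega>: "\<omega> \<in> space \<Omega>"
  shows "(\<lambda>N. T / real (Suc N) * (\<Sum>i = 1..Suc N. indicator {x} (X (real i * (T / real (Suc N))) \<omega>)))
           \<longlonglongrightarrow> local_time X T \<omega> x"
  unfolding local_time_def
proof (rule right_endpoint_sums_tendsto_integral[OF T, where b = 1])
  fix t :: real assume "0 \<le> t"
  from right_continuous[OF \<omega> this]
  show "((\<lambda>s. indicator {x} (X s \<omega>) :: real) \<longlongrightarrow> indicator {x} (X t \<omega>)) (at_right t)"
    by (intro tendsto_eventually) (auto elim: eventually_mono)
qed (simp add: indicator_def)

lemma grid_in_range:
  assumes "chain_range X T \<omega> \<subseteq> S" "0 < T" "i \<in> {1..Suc N}"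
  shows "X (real i * (T / real (Suc N))) \<omega> \<in> S"
proof -
  have "real i * T \<le> real (Suc N) * T" using assms by (intro mult_right_mono) auto
  then have "real i * (T / real (Suc N)) \<le> T"
    by (simp add: divide_simps mult_ac del: of_nat_Suc)
  then show ?thesis using assms unfolding chain_range_def by auto
qed

lemma local_time_nonneg: "0 \<le> local_time X T \<omega> x"
  unfolding local_time_def set_lebesgue_integral_def by (intro integral_nonneg_AE) auto

lemma normalized_local_time_in_prob_measures_on:
  assumes T: "0 < T" and \<omega>: "\<omega> \<in> space \<Omega>" and S: "finite S" and range: "chain_range X T \<omega> \<subseteq> S"
  shows "(\<lambda>x. local_time X T \<omega> x / T) \<in> prob_measures_on S"
proof -
  define c where "c N x = T / real (Suc N) * (\<Sum>i = 1..Suc N. indicator {x} (X (real i * (T / real (Suc N))) \<omega>))" for N x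
  have c_lim: "(\<lambda>N. c N x) \<longlonglongrightarrow> local_time X T \<omega> x" for x
    unfolding c_def by (rule occupation_sums_tendsto_local_time[OF T \<omega>])
  note in_S = grid_in_range[OF range T]
  have c_zero: "c N x = 0" if "x \<notin> S" for N x
  proof -
    have "(\<Sum>i = 1..Suc N. indicator {x} (X (real i * (T / real (Suc N))) \<omega>)) = (0::real)"
    proof (rule sum.neutral, rule ballI)
      fix i assume "i \<in> {1..Suc N}"
      from in_S[OF this] show "indicator {x} (X (real i * (T / real (Suc N))) \<omega>) = (0::real)"
        using that by (auto simp: indicator_def simp del: of_nat_Suc)
    qed
    then show ?thesis unfolding c_def by (simp only: mult_zero_right)
  qed
  have zero: "local_time X T \<omega> x = 0" if "x \<notin> S" for x
  proof (rule LIMSEQ_unique[OF c_lim])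
    show "(\<lambda>N. c N x) \<longlonglongrightarrow> 0" using that c_zero by simp
  qed
  have c_sum: "(\<Sum>x\<in>S. c N x) = T" for N
  proof -
    have "(\<Sum>x\<in>S. indicator {x} (X (real i * (T / real (Suc N))) \<omega>)) = (1::real)" if "i \<in> {1..Suc N}" for i
      using in_S[OF that] S by (simp add: indicator_def del: of_nat_Suc)
    then have "(\<Sum>i = 1..Suc N. \<Sum>x\<in>S. indicator {x} (X (real i * (T / real (Suc N))) \<omega>)) = (\<Sum>i = 1..Suc N. (1::real))"
      by (intro sum.cong) auto
    then show ?thesis
      unfolding c_def by (subst sum_distrib_left[symmetric], subst sum.swap) (simp del: sum.cl_ivl_Suc)
  qed
  have "(\<lambda>N. \<Sum>x\<in>S. c N x) \<longlonglongrightarrow> (\<Sum>x\<in>S. local_time X T \<omega> x)"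
    by (intro tendsto_sum c_lim)
  then have "(\<Sum>x\<in>S. local_time X T \<omega> x) = T"
    by (simp add: c_sum LIMSEQ_const_iff)
  then show ?thesis
    using T zero local_time_nonneg by (simp add: prob_measures_on_def flip: sum_divide_distrib)
qed

section \<open>The Feynman-Kac bound\<close>

lemma tilted_transition_derivative:
  "((\<lambda>h. (transition h x y * exp (h * V y) - (if x = y then 1 else 0)) / h)
      \<longlongrightarrow> A x y + (if x = y then V y else 0)) (at_right 0)"
proof -
  let ?\<delta> = "if x = y then 1 else (0::real)"
  have "((\<lambda>h. exp (h * V y)) has_real_derivative exp (0 * V y) * (1 * V y)) (at 0)"
    by (rule derivative_eq_intros refl | simp)+
  then have "(\<lambda>h. (exp (h * V y) - 1) / h) \<midarrow>0\<rightarrow> V y"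
    by (auto dest: DERIV_D)
  then have e: "((\<lambda>h. (exp (h * V y) - 1) / h) \<longlongrightarrow> V y) (at_right 0)"
    by (rule filterlim_mono) (auto intro: at_le)
  have "((\<lambda>h. exp (h * V y)) \<longlongrightarrow> exp (0 * V y)) (at_right 0)"
    by (intro tendsto_intros)
  then have "((\<lambda>h. (transition h x y - ?\<delta>) / h * exp (h * V y) + ?\<delta> * ((exp (h * V y) - 1) / h))
      \<longlongrightarrow> A x y * exp (0 * V y) + ?\<delta> * V y) (at_right 0)"
    using generator[of x y] unfolding transition_def by (intro tendsto_intros e) auto
  moreover have "(\<lambda>h. (transition h x y - ?\<delta>) / h * exp (h * V y) + ?\<delta> * ((exp (h * V y) - 1) / h))
      = (\<lambda>h. (transition h x y * exp (h * V y) - ?\<delta>) / h)"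
    by (auto simp: fun_eq_iff diff_divide_distrib left_diff_distrib)
  ultimately show ?thesis by (simp split: if_splits)
qed

text \<open>
  The bound is stated through a measurable majorant \<open>H\<close>, namely the lower limit of the discretized
  functionals, each of which depends on finitely many coordinates.  This dispenses with the
  measurability of the event that the range stays in \<open>S\<close>, which involves uncountably many times;
  an upper bound only uses that this event is contained in every grid event.
\<close>

lemma feynman_kac_bound:
  assumes S: "finite S" and a: "a \<in> S" and T: "0 < T"
    and nonpos: "\<And>f. (\<Sum>x\<in>S. \<Sum>y\<in>S. A x y * f x * f y) + (\<Sum>x\<in>S. V x * (f x)\<^sup>2) \<le> 0"
  obtains H where "H \<in> borel_measurable (P a)"
    "\<And>\<omega>. \<omega> \<in> space \<Omega> \<Longrightarrow> chain_range X T \<omega> \<subseteq> S \<Longrightarrow>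
       ennreal (exp (\<Sum>x\<in>S. V x * local_time X T \<omega> x)) \<le> H \<omega>"
    "(\<integral>\<^sup>+ \<omega>. H \<omega> \<partial>P a) \<le> ennreal (sqrt (real (card S)))"
proof -
  define h where "h N = T / real (Suc N)" for N
  have h: "0 < h N" for N using T by (simp add: h_def)
  define W where "W N \<omega> = (\<Prod>i = 1..Suc N. indicator S (X (real i * h N) \<omega>) * exp (h N * V (X (real i * h N) \<omega>)))" for N \<omega>
  define K where "K h x y = transition h x y * exp (h * V y)" for h x y
  define H where "H \<omega> = liminf (\<lambda>N. ennreal (W N \<omega>))" for \<omega>
  have [measurable]: "X (real i * h N) \<in> measurable (P a) (count_space UNIV)" for i N
    using h[of N] by (intro measurable_X_P) simp
  have W_meas [measurable]: "W N \<in> borel_measurable (P a)" for N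
    unfolding W_def by measurable
  have "H \<in> borel_measurable (P a)"
    unfolding H_def by measurable
  moreover have "ennreal (exp (\<Sum>x\<in>S. V x * local_time X T \<omega> x)) \<le> H \<omega>"
    if \<omega>: "\<omega> \<in> space \<Omega>" and range: "chain_range X T \<omega> \<subseteq> S" for \<omega>
  proof -
    have W_eq: "W N \<omega> = exp (\<Sum>x\<in>S. V x * (h N * (\<Sum>i = 1..Suc N. indicator {x} (X (real i * h N) \<omega>))))" for N
    proof -
      note in_S = grid_in_range[OF range T, where N = N, folded h_def]
      have "V (X (real i * h N) \<omega>) = (\<Sum>x\<in>S. V x * indicator {x} (X (real i * h N) \<omega>))" if "i \<in> {1..Suc N}" for i
        using in_S[OF that] S by (simp add: indicator_def if_distrib cong: if_cong)
      then have "(\<Sum>i = 1..Suc N. h N * V (X (real i * h N) \<omega>))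
          = (\<Sum>i = 1..Suc N. \<Sum>x\<in>S. V x * (h N * indicator {x} (X (real i * h N) \<omega>)))"
        by (intro sum.cong refl) (simp add: sum_distrib_left mult_ac)
      also have "\<dots> = (\<Sum>x\<in>S. V x * (h N * (\<Sum>i = 1..Suc N. indicator {x} (X (real i * h N) \<omega>))))"
        by (subst sum.swap) (simp only: sum_distrib_left)
      finally have *: "(\<Sum>i = 1..Suc N. h N * V (X (real i * h N) \<omega>)) = \<dots>" .
      have "W N \<omega> = (\<Prod>i = 1..Suc N. exp (h N * V (X (real i * h N) \<omega>)))"
        unfolding W_def using in_S by (intro prod.cong) auto
      also have "\<dots> = exp (\<Sum>i = 1..Suc N. h N * V (X (real i * h N) \<omega>))"
        by (rule exp_sum[symmetric]) simp
      finally show ?thesis unfolding * .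
    qed
    have "(\<lambda>N. W N \<omega>) \<longlonglongrightarrow> exp (\<Sum>x\<in>S. V x * local_time X T \<omega> x)"
      unfolding W_eq h_def by (intro tendsto_intros occupation_sums_tendsto_local_time T \<omega>)
    then have "(\<lambda>N. ennreal (W N \<omega>)) \<longlonglongrightarrow> ennreal (exp (\<Sum>x\<in>S. V x * local_time X T \<omega> x))"
      by (rule tendsto_ennrealI)
    then show ?thesis unfolding H_def by (simp add: lim_imp_Liminf)
  qed
  moreover have "(\<integral>\<^sup>+ \<omega>. H \<omega> \<partial>P a) \<le> ennreal (sqrt (real (card S)))"
  proof -
    have bound: "(\<integral>\<^sup>+ \<omega>. H \<omega> \<partial>P a) \<le> ennreal (sqrt (exp (\<epsilon> * T) * real (card S)))" if \<epsilon>: "0 < \<epsilon>" for \<epsilon>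
    proof -
      have "eventually (\<lambda>h. \<forall>f. (\<Sum>x\<in>S. (\<Sum>y\<in>S. K h x y * f y)\<^sup>2) \<le> (1 + \<epsilon> * h) * (\<Sum>x\<in>S. (f x)\<^sup>2)) (at_right 0)"
      proof (rule eventually_near_isometry[OF S \<epsilon>, where G = "\<lambda>x y. A x y + (if x = y then V y else 0)"])
        fix f :: "'a \<Rightarrow> real"
        have "(\<Sum>x\<in>S. \<Sum>y\<in>S. (A x y + (if x = y then V y else 0)) * f x * f y)
            = (\<Sum>x\<in>S. \<Sum>y\<in>S. A x y * f x * f y) + (\<Sum>x\<in>S. \<Sum>y\<in>S. if x = y then V y * f x * f y else 0)"
          by (simp add: distrib_right if_distrib[of "\<lambda>c. c * _"] sum.distrib cong: if_cong)
        also have "(\<Sum>x\<in>S. \<Sum>y\<in>S. if x = y then V y * f x * f y else 0) = (\<Sum>x\<in>S. V x * (f x)\<^sup>2)"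
          using S by (simp add: power2_eq_square mult_ac)
        finally show "(\<Sum>x\<in>S. \<Sum>y\<in>S. (A x y + (if x = y then V y else 0)) * f x * f y) \<le> 0"
          using nonpos[of f] by simp
      qed (unfold K_def, rule tilted_transition_derivative)
      moreover have "h \<longlonglongrightarrow> 0"
        unfolding h_def using tendsto_mult[OF tendsto_const[of T] LIMSEQ_inverse_real_of_nat]
        by (simp add: divide_inverse)
      then have "filterlim h (at_right 0) sequentially"
        using h by (simp add: filterlim_at less_imp_neq[symmetric])
      ultimately have "eventually (\<lambda>N. \<forall>f. (\<Sum>x\<in>S. (\<Sum>y\<in>S. K (h N) x y * f y)\<^sup>2) \<le> (1 + \<epsilon> * h N) * (\<Sum>x\<in>S. (f x)\<^sup>2)) sequentially"
        by (rule eventually_compose_filterlim)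
      then have ev: "eventually (\<lambda>N. (\<integral>\<^sup>+ \<omega>. ennreal (W N \<omega>) \<partial>P a) \<le> ennreal (sqrt (exp (\<epsilon> * T) * real (card S)))) sequentially"
      proof eventually_elim
        case (elim N)
        have pos: "0 \<le> 1 + \<epsilon> * h N" using \<epsilon> h[of N] by (simp add: add_nonneg_nonneg)
        have "(kernel_iter (K (h N)) S (Suc N) a)\<^sup>2 \<le> (\<Sum>x\<in>S. (kernel_iter (K (h N)) S (Suc N) x)\<^sup>2)"
          using S a by (intro member_le_sum) auto
        also have "\<dots> \<le> (1 + \<epsilon> * h N) ^ Suc N * real (card S)"
          using elim pos by (intro kernel_iter_sum_squares_le) auto
        also have "\<dots> \<le> exp (\<epsilon> * h N) ^ Suc N * real (card S)"
          using pos by (intro mult_right_mono power_mono) (auto simp: exp_ge_add_one_self)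
        also have "exp (\<epsilon> * h N) ^ Suc N = exp (\<epsilon> * T)"
          by (subst exp_of_nat_mult[symmetric]) (simp add: h_def)
        finally have "kernel_iter (K (h N)) S (Suc N) a \<le> sqrt (exp (\<epsilon> * T) * real (card S))"
          by (rule real_le_rsqrt)
        moreover have "(\<integral>\<^sup>+ \<omega>. ennreal (W N \<omega>) \<partial>P a) = ennreal (kernel_iter (K (h N)) S (Suc N) a)"
          unfolding W_def K_def using h[of N] by (intro grid_expectation S) auto
        ultimately show ?case by (simp add: ennreal_leI)
      qed
      have "(\<integral>\<^sup>+ \<omega>. H \<omega> \<partial>P a) \<le> liminf (\<lambda>N. \<integral>\<^sup>+ \<omega>. ennreal (W N \<omega>) \<partial>P a)"
        unfolding H_def by (rule nn_integral_liminf) simp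
      also have "\<dots> \<le> limsup (\<lambda>N. \<integral>\<^sup>+ \<omega>. ennreal (W N \<omega>) \<partial>P a)"
        by (rule Liminf_le_Limsup) simp
      also have "\<dots> \<le> ennreal (sqrt (exp (\<epsilon> * T) * real (card S)))"
        by (rule Limsup_bounded[OF ev])
      finally show ?thesis .
    qed
    have "((\<lambda>\<epsilon>. ennreal (sqrt (exp (\<epsilon> * T) * real (card S)))) \<longlongrightarrow> ennreal (sqrt (exp (0 * T) * real (card S)))) (at_right 0)"
      by (intro tendsto_ennrealI tendsto_intros)
    moreover have "eventually (\<lambda>\<epsilon>. (\<integral>\<^sup>+ \<omega>. H \<omega> \<partial>P a) \<le> ennreal (sqrt (exp (\<epsilon> * T) * real (card S)))) (at_right 0)"
      using eventually_at_right_less[of "0::real"] by eventually_elim (rule bound)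
    ultimately have "(\<integral>\<^sup>+ \<omega>. H \<omega> \<partial>P a) \<le> ennreal (sqrt (exp (0 * T) * real (card S)))"
      by (rule tendsto_lowerbound) simp
    then show ?thesis by simp
  qed
  ultimately show thesis using that by blast
qed

section \<open>The exponential moment of the Dirichlet form\<close>

text \<open>
  For each path some net point \<open>k\<close> satisfies \<open>T I(\<ell>\<^sub>T / T) \<le> \<Sum>\<^sub>x V\<^sub>k(x) \<ell>\<^sub>T(x) + loss\<close>; replacing the
  path-dependent choice by the sum over the net makes the Feynman-Kac bound applicable to every term.
\<close>

lemma dirichlet_exponential_moment:
  assumes S: "finite S" and a: "a \<in> S" and T: "1 \<le> T" and sym: "\<And>x y. A x y = A y x"
  obtains H where "H \<in> borel_measurable (P a)"
    "\<And>\<omega>. \<omega> \<in> space \<Omega> \<Longrightarrow> chain_range X T \<omega> \<subseteq> S \<Longrightarrow>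
       ennreal (exp (T * dirichlet_form A S (\<lambda>x. sqrt (local_time X T \<omega> x / T)))) \<le> H \<omega>"
    "(\<integral>\<^sup>+ \<omega>. H \<omega> \<partial>P a) \<le> ennreal (exp (error_term A S T))"
proof -
  define U where "U = PiE S (\<lambda>_. {1..max 1 (nat \<lceil>eta A S * T\<rceil>)})"
  define V where "V k = ground_state_potential A S (\<lambda>x. real (k x))" for k :: "'a \<Rightarrow> nat"
  have S': "S \<noteq> {}" and T': "0 < T" using a T by auto
  have U: "finite U" "card U = max 1 (nat \<lceil>eta A S * T\<rceil>) ^ card S"
    using S by (auto simp: U_def card_PiE intro: finite_PiE)
  have off: "0 \<le> A x y" if "x \<noteq> y" for x y
    using conservative that unfolding conservative_generator_def by blast
  have "\<exists>H. H \<in> borel_measurable (P a) \<and>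
      (\<forall>\<omega>. \<omega> \<in> space \<Omega> \<longrightarrow> chain_range X T \<omega> \<subseteq> S \<longrightarrow>
        ennreal (exp (\<Sum>x\<in>S. V k x * local_time X T \<omega> x)) \<le> H \<omega>) \<and>
      (\<integral>\<^sup>+ \<omega>. H \<omega> \<partial>P a) \<le> ennreal (sqrt (real (card S)))" if "k \<in> U" for k
  proof -
    have "1 \<le> k x" if "x \<in> S" for x
      using \<open>k \<in> U\<close> that by (auto simp: U_def PiE_iff)
    then have "0 < real (k x)" if "x \<in> S" for x using that by fastforce
    then have "(\<Sum>x\<in>S. \<Sum>y\<in>S. A x y * f x * f y) + (\<Sum>x\<in>S. V k x * (f x)\<^sup>2) \<le> 0" for f
      unfolding V_def by (intro ground_state_form_nonpos S sym off)
    from feynman_kac_bound[OF S a T' this] show ?thesis by blast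
  qed
  then obtain H where H: "\<And>k. k \<in> U \<Longrightarrow> H k \<in> borel_measurable (P a)"
    "\<And>k \<omega>. k \<in> U \<Longrightarrow> \<omega> \<in> space \<Omega> \<Longrightarrow> chain_range X T \<omega> \<subseteq> S \<Longrightarrow>
        ennreal (exp (\<Sum>x\<in>S. V k x * local_time X T \<omega> x)) \<le> H k \<omega>"
    "\<And>k. k \<in> U \<Longrightarrow> (\<integral>\<^sup>+ \<omega>. H k \<omega> \<partial>P a) \<le> ennreal (sqrt (real (card S)))"
    by metis
  define L where "L = exp (rounding_loss (card S))"
  define G where "G \<omega> = ennreal L * (\<Sum>k\<in>U. H k \<omega>)" for \<omega>
  have "G \<in> borel_measurable (P a)"
    unfolding G_def using H(1) by measurable
  moreover have "ennreal (exp (T * dirichlet_form A S (\<lambda>x. sqrt (local_time X T \<omega> x / T)))) \<le> G \<omega>"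
    if \<omega>: "\<omega> \<in> space \<Omega>" "chain_range X T \<omega> \<subseteq> S" for \<omega>
  proof -
    let ?l = "local_time X T \<omega>"
    have "(\<Sum>x\<in>S. ?l x / T) = 1"
      using normalized_local_time_in_prob_measures_on[OF T' \<omega>(1) S \<omega>(2)] by (simp add: prob_measures_on_def)
    then have "(\<Sum>x\<in>S. ?l x) = T" using T' by (simp flip: sum_divide_distrib)
    from dirichlet_form_rounding[where A = A, OF S S' off T' local_time_nonneg this]
    obtain k where k: "k \<in> U"
      "dirichlet_form A S (\<lambda>x. sqrt (?l x)) \<le> (\<Sum>x\<in>S. V k x * ?l x) + rounding_loss (card S)"
      unfolding U_def V_def by metis
    have "T * dirichlet_form A S (\<lambda>x. sqrt (?l x / T)) = dirichlet_form A S (\<lambda>x. sqrt (?l x))"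
      using T' by (simp add: dirichlet_form_def real_sqrt_divide sum_distrib_left)
    then have "exp (T * dirichlet_form A S (\<lambda>x. sqrt (?l x / T))) \<le> L * exp (\<Sum>x\<in>S. V k x * ?l x)"
      using k(2) by (simp add: L_def add.commute flip: exp_add)
    then have "ennreal (exp (T * dirichlet_form A S (\<lambda>x. sqrt (?l x / T))))
        \<le> ennreal L * ennreal (exp (\<Sum>x\<in>S. V k x * ?l x))"
      by (simp add: L_def ennreal_leI flip: ennreal_mult)
    also have "\<dots> \<le> ennreal L * H k \<omega>"
      using H(2)[OF k(1) \<omega>] by (rule mult_left_mono) simp
    also have "\<dots> \<le> G \<omega>"
      unfolding G_def using U(1) k(1) by (intro mult_left_mono member_le_sum) auto
    finally show ?thesis .
  qed
  moreover have "(\<integral>\<^sup>+ \<omega>. G \<omega> \<partial>P a) \<le> ennreal (exp (error_term A S T))"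
  proof -
    have "(\<integral>\<^sup>+ \<omega>. G \<omega> \<partial>P a) = ennreal L * (\<Sum>k\<in>U. \<integral>\<^sup>+ \<omega>. H k \<omega> \<partial>P a)"
      unfolding G_def using H(1) by (subst nn_integral_cmult) (auto simp: nn_integral_sum)
    also have "\<dots> \<le> ennreal L * (\<Sum>k\<in>U. ennreal (sqrt (real (card S))))"
      using H(3) by (intro mult_left_mono sum_mono) auto
    also have "\<dots> = ennreal (L * (real (max 1 (nat \<lceil>eta A S * T\<rceil>)) ^ card S * sqrt (real (card S))))"
      by (subst sum_ennreal) (simp_all add: L_def U ennreal_mult)
    also have "\<dots> \<le> ennreal (exp (error_term A S T))"
      unfolding L_def by (intro ennreal_leI entropy_le_error_term S S' T)
    finally show ?thesis .
  qed
  ultimately show thesis using that by blast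
qed

end

section \<open>The large deviation bounds\<close>

lemma log_ennreal_le:
  assumes "p \<le> ennreal (exp r)"
  shows "log_ennreal p \<le> ereal r"
proof (cases "p = 0")
  case False
  have "p < \<infinity>" using assms by (rule order.strict_trans1) simp
  moreover from this False have "0 < enn2real p" by (simp add: enn2real_positive_iff zero_less_iff_neq_zero)
  moreover have "enn2real p \<le> exp r" using assms by (rule enn2real_leI[rotated]) simp
  ultimately have "ln (enn2real p) \<le> r" using ln_le_cancel_iff[of "enn2real p" "exp r"] by simp
  then show ?thesis using False \<open>p < \<infinity>\<close> by (simp add: log_ennreal_def)
qed (simp add: log_ennreal_def)

theorem theorem3p6:
  fixes \<Omega> :: "'w measure"
    and P :: "'a::countable \<Rightarrow> 'w measure"
    and X :: "real \<Rightarrow> 'w \<Rightarrow> 'a"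
    and A :: "'a \<Rightarrow> 'a \<Rightarrow> real"
    and S :: "'a set"
    and T :: real
    and a :: 'a
  assumes two_elements: "\<exists>x y :: 'a. x \<noteq> y"
    and chain: "continuous_time_markov_chain \<Omega> P X A"
    and symmetric: "\<And>x y. A x y = A y x"
    and finite_S: "finite S"
    and T: "1 \<le> T"
    and a: "a \<in> S"
  shows
    "(\<forall>\<Gamma>. \<Gamma> \<subseteq> prob_measures_on S \<longrightarrow> \<Gamma> \<in> sets (prob_measures_borel S) \<longrightarrow>
        log_ennreal (emeasure (P a)
          {\<omega> \<in> space \<Omega>. (\<lambda>x. local_time X T \<omega> x / T) \<in> \<Gamma> \<and> chain_range X T \<omega> \<subseteq> S})
        \<le> - (ereal T * (INF \<mu>\<in>\<Gamma>. ereal (dirichlet_form A S (\<lambda>x. sqrt (\<mu> x)))))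
           + ereal (error_term A S T)) \<and>
     (\<forall>F :: ('a \<Rightarrow> real) \<Rightarrow> real. F \<in> borel_measurable (prob_measures_borel S) \<longrightarrow>
        log_ennreal (\<integral>\<^sup>+ \<omega>. ennreal (exp (T * F (\<lambda>x. local_time X T \<omega> x / T)))
            * indicator {\<omega> \<in> space \<Omega>. chain_range X T \<omega> \<subseteq> S} \<omega> \<partial>P a)
        \<le> ereal T * (SUP \<mu>\<in>prob_measures_on S.
              ereal (F \<mu> - dirichlet_form A S (\<lambda>x. sqrt (\<mu> x))))
           + ereal (error_term A S T))"
proof -
  interpret continuous_time_markov_chain \<Omega> P X A by (rule chain)
  define I where "I \<mu> = dirichlet_form A S (\<lambda>x. sqrt (\<mu> x))" for \<mu>
  define \<mu> where "\<mu> \<omega> = (\<lambda>x. local_time X T \<omega> x / T)" for \<omega>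
  obtain H where H_meas: "H \<in> borel_measurable (P a)"
    and H_ge: "\<And>\<omega>. \<omega> \<in> space \<Omega> \<Longrightarrow> chain_range X T \<omega> \<subseteq> S \<Longrightarrow> ennreal (exp (T * I (\<mu> \<omega>))) \<le> H \<omega>"
    and H_int: "(\<integral>\<^sup>+ \<omega>. H \<omega> \<partial>P a) \<le> ennreal (exp (error_term A S T))"
    using dirichlet_exponential_moment[OF finite_S a T symmetric] unfolding I_def \<mu>_def by blast
  have scaled: "log_ennreal p \<le> ereal (c + error_term A S T)"
    if "p \<le> (\<integral>\<^sup>+ \<omega>. ennreal (exp c) * H \<omega> \<partial>P a)" for p c
  proof (rule log_ennreal_le)
    note that
    also have "(\<integral>\<^sup>+ \<omega>. ennreal (exp c) * H \<omega> \<partial>P a) = ennreal (exp c) * (\<integral>\<^sup>+ \<omega>. H \<omega> \<partial>P a)"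
      by (rule nn_integral_cmult[OF H_meas])
    also have "\<dots> \<le> ennreal (exp c) * ennreal (exp (error_term A S T))"
      using H_int by (rule mult_left_mono) simp
    finally show "p \<le> ennreal (exp (c + error_term A S T))"
      by (simp add: exp_add ennreal_mult)
  qed
  show ?thesis
    unfolding I_def[symmetric] \<mu>_def[symmetric]
  proof (intro conjI allI impI)
    fix \<Gamma>
    define E where "E = {\<omega> \<in> space \<Omega>. \<mu> \<omega> \<in> \<Gamma> \<and> chain_range X T \<omega> \<subseteq> S}"
    define m where "m = (INF \<mu>\<in>\<Gamma>. ereal (I \<mu>))"
    have m_le: "m \<le> ereal (I (\<mu> \<omega>))" if "\<omega> \<in> E" for \<omega>
      using that unfolding m_def E_def by (auto intro: INF_lower)
    \<comment> \<open>Outside the \<open>\<sigma>\<close>-algebra \<open>emeasure\<close> has the default value \<open>0\<close>, whose logarithm is \<open>- \<infinity>\<close>.\<close>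
    show "log_ennreal (emeasure (P a) E) \<le> - (ereal T * m) + ereal (error_term A S T)"
    proof (cases "E \<in> sets (P a)")
      case False
      then show ?thesis by (simp add: emeasure_notin_sets log_ennreal_def)
    next
      case True
      show ?thesis
      proof (cases m)
        \<comment> \<open>The Dirichlet form is finite, so the infimum is \<open>\<infinity>\<close> only over an empty \<open>\<Gamma>\<close>.\<close>
        case PInf
        then have "E = {}" using m_le by auto
        then show ?thesis by (simp add: log_ennreal_def)
      next
        case MInf
        then show ?thesis using T by simp
      next
        case (real r)
        have "emeasure (P a) E = (\<integral>\<^sup>+ \<omega>. indicator E \<omega> \<partial>P a)"
          using True by simp
        also have "\<dots> \<le> (\<integral>\<^sup>+ \<omega>. ennreal (exp (- (T * r))) * H \<omega> \<partial>P a)"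
        proof (rule nn_integral_mono)
          fix \<omega>
          show "indicator E \<omega> \<le> ennreal (exp (- (T * r))) * H \<omega>"
          proof (cases "\<omega> \<in> E")
            case True
            have "r \<le> I (\<mu> \<omega>)" using m_le[OF True] real by simp
            then have "1 \<le> exp (- (T * r)) * exp (T * I (\<mu> \<omega>))"
              using T by (simp flip: exp_add)
            then have "1 \<le> ennreal (exp (- (T * r))) * ennreal (exp (T * I (\<mu> \<omega>)))"
              by (simp flip: ennreal_mult add: ennreal_leI)
            also have "\<dots> \<le> ennreal (exp (- (T * r))) * H \<omega>"
              using True by (intro mult_left_mono H_ge) (auto simp: E_def)
            finally show ?thesis using True by simp
          qed simp
        qed
        finally have "log_ennreal (emeasure (P a) E) \<le> ereal (- (T * r) + error_term A S T)"
          by (rule scaled)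
        then show ?thesis using real by simp
      qed
    qed
  next
    fix F :: "('a \<Rightarrow> real) \<Rightarrow> real"
    define s where "s = (SUP \<mu>\<in>prob_measures_on S. ereal (F \<mu> - I \<mu>))"
    have s_ge: "ereal (F \<nu> - I \<nu>) \<le> s" if "\<nu> \<in> prob_measures_on S" for \<nu>
      using that unfolding s_def by (rule SUP_upper)
    \<comment> \<open>Any element of the index set rules out a supremum of \<open>- \<infinity>\<close>, for which the product with \<open>T\<close>
       would be \<open>- \<infinity>\<close>.\<close>
    have "indicator {a} \<in> prob_measures_on S"
      using a finite_S by (auto simp: prob_measures_on_def indicator_def)
    from s_ge[OF this] have "s \<noteq> - \<infinity>" by auto
    then consider "s = \<infinity>" | r where "s = ereal r" by (cases s) auto
    then show "log_ennreal (\<integral>\<^sup>+ \<omega>. ennreal (exp (T * F (\<mu> \<omega>)))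
            * indicator {\<omega> \<in> space \<Omega>. chain_range X T \<omega> \<subseteq> S} \<omega> \<partial>P a)
        \<le> ereal T * s + ereal (error_term A S T)"
    proof cases
      case 1
      then show ?thesis using T by simp
    next
      case (2 r)
      have "(\<integral>\<^sup>+ \<omega>. ennreal (exp (T * F (\<mu> \<omega>)))
            * indicator {\<omega> \<in> space \<Omega>. chain_range X T \<omega> \<subseteq> S} \<omega> \<partial>P a)
          \<le> (\<integral>\<^sup>+ \<omega>. ennreal (exp (T * r)) * H \<omega> \<partial>P a)"
      proof (rule nn_integral_mono)
        fix \<omega>
        show "ennreal (exp (T * F (\<mu> \<omega>))) * indicator {\<omega> \<in> space \<Omega>. chain_range X T \<omega> \<subseteq> S} \<omega>
            \<le> ennreal (exp (T * r)) * H \<omega>"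
        proof (cases "\<omega> \<in> space \<Omega> \<and> chain_range X T \<omega> \<subseteq> S")
          case True
          then have "\<mu> \<omega> \<in> prob_measures_on S"
            unfolding \<mu>_def using T finite_S by (intro normalized_local_time_in_prob_measures_on) auto
          from s_ge[OF this] have "F (\<mu> \<omega>) \<le> r + I (\<mu> \<omega>)" using 2 by simp
          then have "T * F (\<mu> \<omega>) \<le> T * (r + I (\<mu> \<omega>))" using T by (intro mult_left_mono) auto
          then have "exp (T * F (\<mu> \<omega>)) \<le> exp (T * r) * exp (T * I (\<mu> \<omega>))"
            by (simp add: distrib_left flip: exp_add)
          then have "ennreal (exp (T * F (\<mu> \<omega>))) \<le> ennreal (exp (T * r)) * ennreal (exp (T * I (\<mu> \<omega>)))"
            by (simp flip: ennreal_mult add: ennreal_leI)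
          also have "\<dots> \<le> ennreal (exp (T * r)) * H \<omega>"
            using True by (intro mult_left_mono H_ge) auto
          finally show ?thesis using True by simp
        qed auto
      qed
      from scaled[OF this] show ?thesis using 2 by simp
    qed
  qed
qed

end
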